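(* Let $a>0$, $b>0$, and let $p(t,x)$ be the probability density function of the Variance Gamma process $X$ with parameters $a,b$. Then $p$ satisfies the differential equation $$x\,\frac{\partial^2}{\partial x^2}p(t,x)-(2at-2)\,\frac{\partial}{\partial x}p(t,x)-b\,x\,p(t,x)=0,\qquad t>0,\ x\in\mathbb{R},$$ with $p(0,x)=\delta(x)$.
   Context: Fix $a,b>0$. Let $H=\{H_t,t\ge 0\}$ be the Gamma subordinator started at $0$ with $\mathbf{E}[e^{-\lambda H_t}]=e^{-t\,a\ln(1+\lambda/b)}$ for $\lambda>0$; for $t>0$ its density is $h(t,s)=\frac{b^{at}}{\Gamma(at)}s^{at-1}e^{-bs}$ for $s>0$ and $h(t,s)=0$ for $s\le 0$. Let $B=\{B_t,t\ge0\}$ be a one-dimensional Brownian motion started at $0$, independent of $H$, with density $g(t,x)=e^{-x^2/(4t)}/\sqrt{4\pi t}$ (so $B_t$ has variance $2t$). The Variance Gamma process is $X_t=B_{H_t}$; its density is $p(t,x)=\int_0^\infty g(s,x)h(t,s)\,ds$ for $t>0$. $\delta$ is the Dirac delta at $0$.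
   Formalization: At x = 0 the pointwise equation is claimed only when at > 3/2, since for at ≤ 3/2 the density is not twice differentiable there (for at = 1 it has a corner); for every t > 0 the equation is also proved on all of ℝ in the sense of distributions. *)

theory Defs
  imports "HOL-Probability.Probability"
begin

text \<open>Processes are functions of a real time, of which only times \<open>t \<ge> 0\<close> matter.\<close>

definition (in prob_space) independent_increments :: "(real \<Rightarrow> 'a \<Rightarrow> real) \<Rightarrow> bool" where
  "independent_increments X \<longleftrightarrow>
     (\<forall>\<tau> :: nat \<Rightarrow> real. \<forall>n. 0 \<le> \<tau> 0 \<and> mono \<tau> \<longrightarrow>
        indep_vars (\<lambda>_. borel) (\<lambda>i \<omega>. X (\<tau> (Suc i)) \<omega> - X (\<tau> i) \<omega>) {..<n})"

definition (in prob_space) stationary_increments :: "(real \<Rightarrow> 'a \<Rightarrow> real) \<Rightarrow> bool" where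
  "stationary_increments X \<longleftrightarrow>
     (\<forall>s t. 0 \<le> s \<and> s \<le> t \<longrightarrow>
        distr M borel (\<lambda>\<omega>. X t \<omega> - X s \<omega>) = distr M borel (X (t - s)))"

text \<open>Density of a Brownian motion normalised to have variance \<open>2 * t\<close> at time \<open>t\<close>.\<close>

definition heat_density :: "real \<Rightarrow> real \<Rightarrow> real" where
  "heat_density t x = exp (- x\<^sup>2 / (4 * t)) / sqrt (4 * pi * t)"

definition gamma_sub_density :: "real \<Rightarrow> real \<Rightarrow> real \<Rightarrow> real \<Rightarrow> real" where
  "gamma_sub_density a b t s =
     (if 0 < s then b powr (a * t) / Gamma (a * t) * s powr (a * t - 1) * exp (- b * s) else 0)"

text \<open>The path properties of the next two definitions are required for every \<open>\<omega>\<close>, not just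
  almost every one, so that \<open>B (H t \<omega>) \<omega>\<close> below is measurable in \<open>\<omega>\<close> even if \<open>M\<close> is
  not complete.\<close>

definition (in prob_space) brownian_motion :: "(real \<Rightarrow> 'a \<Rightarrow> real) \<Rightarrow> bool" where
  "brownian_motion B \<longleftrightarrow>
     (\<forall>t\<ge>0. random_variable borel (B t)) \<and>
     (\<forall>\<omega>\<in>space M. B 0 \<omega> = 0) \<and>
     (\<forall>\<omega>\<in>space M. continuous_on {0..} (\<lambda>t. B t \<omega>)) \<and>
     independent_increments B \<and>
     (\<forall>s t. 0 \<le> s \<and> s < t \<longrightarrow>
        distributed M lborel (\<lambda>\<omega>. B t \<omega> - B s \<omega>) (\<lambda>x. ennreal (heat_density (t - s) x)))"

definition (in prob_space) subordinator :: "(real \<Rightarrow> 'a \<Rightarrow> real) \<Rightarrow> bool" where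
  "subordinator H \<longleftrightarrow>
     (\<forall>t\<ge>0. random_variable borel (H t)) \<and>
     (\<forall>\<omega>\<in>space M. H 0 \<omega> = 0) \<and>
     (\<forall>\<omega>\<in>space M. mono_on {0..} (\<lambda>t. H t \<omega>)) \<and>
     (\<forall>\<omega>\<in>space M. \<forall>t\<ge>0. continuous (at_right t) (\<lambda>t. H t \<omega>)) \<and>
     independent_increments H \<and> stationary_increments H"

definition (in prob_space) gamma_subordinator ::
    "real \<Rightarrow> real \<Rightarrow> (real \<Rightarrow> 'a \<Rightarrow> real) \<Rightarrow> bool" where
  "gamma_subordinator a b H \<longleftrightarrow>
     subordinator H \<and>
     (\<forall>t\<ge>0. \<forall>l>0. expectation (\<lambda>\<omega>. exp (- l * H t \<omega>)) = exp (- t * a * ln (1 + l / b)))"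

text \<open>Independence of two processes: of the path-valued random variables, with the product
  \<open>\<sigma>\<close>-algebra on paths.\<close>

definition (in prob_space) independent_processes ::
    "(real \<Rightarrow> 'a \<Rightarrow> real) \<Rightarrow> (real \<Rightarrow> 'a \<Rightarrow> real) \<Rightarrow> bool" where
  "independent_processes X Y \<longleftrightarrow>
     indep_var (Pi\<^sub>M {0..} (\<lambda>_. borel)) (\<lambda>\<omega>. \<lambda>t\<in>{0..}. X t \<omega>)
               (Pi\<^sub>M {0..} (\<lambda>_. borel)) (\<lambda>\<omega>. \<lambda>t\<in>{0..}. Y t \<omega>)"

definition subordinated :: "(real \<Rightarrow> 'a \<Rightarrow> real) \<Rightarrow> (real \<Rightarrow> 'a \<Rightarrow> real) \<Rightarrow> real \<Rightarrow> 'a \<Rightarrow> real" where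
  "subordinated B H t \<omega> = B (H t \<omega>) \<omega>"

text \<open>The mixture density, a particular version that can be differentiated pointwise.  For
  \<open>a * t \<le> 1/2\<close> it is infinite at \<open>x = 0\<close>, where the integral below is \<open>0\<close> by convention.\<close>

definition vg_density :: "real \<Rightarrow> real \<Rightarrow> real \<Rightarrow> real \<Rightarrow> real" where
  "vg_density a b t x = (LBINT s:{0<..}. heat_density s x * gamma_sub_density a b t s)"

text \<open>Distributions on the real line, as functionals on smooth functions of compact support.\<close>

definition test_function :: "(real \<Rightarrow> real) \<Rightarrow> bool" where
  "test_function \<phi> \<longleftrightarrow>
     (\<forall>n x. ((deriv ^^ n) \<phi>) field_differentiable (at x)) \<and> (\<exists>R. \<forall>x. R < \<bar>x\<bar> \<longrightarrow> \<phi> x = 0)"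

definition regular_dist :: "(real \<Rightarrow> real) \<Rightarrow> (real \<Rightarrow> real) \<Rightarrow> real" where
  "regular_dist f \<phi> = (LBINT x. f x * \<phi> x)"

definition dist_deriv :: "((real \<Rightarrow> real) \<Rightarrow> real) \<Rightarrow> (real \<Rightarrow> real) \<Rightarrow> real" where
  "dist_deriv T \<phi> = - T (deriv \<phi>)"

definition dist_mult :: "(real \<Rightarrow> real) \<Rightarrow> ((real \<Rightarrow> real) \<Rightarrow> real) \<Rightarrow> (real \<Rightarrow> real) \<Rightarrow> real" where
  "dist_mult m T \<phi> = T (\<lambda>x. m x * \<phi> x)"

end

theory Submission
  imports Defs "HOL-Real_Asymp.Real_Asymp"
begin

text \<open>
  Up to a constant, \<open>p t x\<close> equals \<open>G k (x\<^sup>2 / 4)\<close> with \<open>k = a * t - 3 / 2\<close> and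
  \<open>G k c\<close> the integral over \<open>s > 0\<close> of \<open>s powr k * exp (- c / s - b * s)\<close>.
  Differentiation in \<open>c\<close> lowers \<open>k\<close> by one, and integrating the derivative in \<open>s\<close> of the
  integrand gives a three-term recurrence in \<open>k\<close>; together they are the equation away from \<open>0\<close>.
  Across \<open>0\<close> the equation is the statement that
  \<open>x * p * \<phi>' - (x * p' - (2 * a * t - 1) * p) * \<phi>\<close> is a primitive of the integrand of the
  weak formulation. By the recurrence the bracket is a multiple of \<open>G (k + 1)\<close>, so this
  primitive is continuous at \<open>0\<close> whatever the size of \<open>a * t\<close>.

  That \<open>p t\<close> is the density needs no identification of the law of \<open>H t\<close>: the characteristic
  function of \<open>B\<close> at time \<open>H t\<close> is the Laplace transform of \<open>H t\<close> at \<open>u\<^sup>2\<close>, and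
  that of \<open>p t\<close> is a Gamma integral with the same value.
\<close>

section \<open>The integrals \<open>G k c\<close>\<close>

text \<open>Up to normalisation this is the generalised inverse Gaussian density. For
  \<open>b, c > 0\<close> its integral is \<open>2 * (c / b) powr ((k + 1) / 2)\<close> times the
  modified Bessel function K of order \<open>k + 1\<close> at
  \<open>2 * sqrt (b * c)\<close>.\<close>

definition gig_weight :: "real \<Rightarrow> real \<Rightarrow> real \<Rightarrow> real \<Rightarrow> real" where
  "gig_weight b k c s = indicator {0<..} s * (s powr k * exp (- (c / s) - b * s))"

definition gig_integral :: "real \<Rightarrow> real \<Rightarrow> real \<Rightarrow> real" where
  "gig_integral b k c = (LBINT s. gig_weight b k c s)"

lemma gig_weight_nonneg: "gig_weight b k c s \<ge> 0"
  by (simp add: gig_weight_def)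

lemma gig_weight_measurable [measurable]: "gig_weight b k c \<in> borel_measurable borel"
  unfolding gig_weight_def by measurable

text \<open>Euler's integral for Gamma, rescaled by \<open>b\<close>. Working with nonnegative
  integrals yields integrability and value at once.\<close>

lemma nn_integral_gig_weight_0:
  assumes "b > 0" "k > -1"
  shows "(\<integral>\<^sup>+s. ennreal (gig_weight b k 0 s) \<partial>lborel) = ennreal (Gamma (k + 1) / b powr (k + 1))"
proof -
  have "ennreal (Gamma (k + 1)) =
      (\<integral>\<^sup>+t. ennreal (indicator {0..} t * t powr k / exp t) \<partial>lborel)"
    using Gamma_conv_nn_integral_real[of "k + 1"] assms by simp
  also have "\<dots> = \<bar>b\<bar> * (\<integral>\<^sup>+s. ennreal (indicator {0..} (0 + b * s) * (0 + b * s) powr k / exp (0 + b * s)) \<partial>lborel)"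
    by (rule nn_integral_real_affine) (use assms in auto)
  also have "\<dots> = ennreal b * (\<integral>\<^sup>+s. ennreal (b powr k) * ennreal (gig_weight b k 0 s) \<partial>lborel)"
    using assms
    by (intro arg_cong2[of _ _ _ _ "(*)"] nn_integral_cong)
      (auto simp: gig_weight_def indicator_def powr_mult exp_minus divide_simps zero_le_mult_iff
         ennreal_mult' [symmetric])
  also have "\<dots> = ennreal (b powr (k + 1)) * (\<integral>\<^sup>+s. ennreal (gig_weight b k 0 s) \<partial>lborel)"
    using assms by (subst nn_integral_cmult)
      (auto simp: powr_add mult.assoc [symmetric] ennreal_mult' [symmetric] mult.commute)
  finally have *: "ennreal (Gamma (k + 1)) = ennreal (b powr (k + 1)) * (\<integral>\<^sup>+s. ennreal (gig_weight b k 0 s) \<partial>lborel)" .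
  have "(\<integral>\<^sup>+s. ennreal (gig_weight b k 0 s) \<partial>lborel) =
      ennreal (1 / b powr (k + 1)) * (ennreal (b powr (k + 1)) * (\<integral>\<^sup>+s. ennreal (gig_weight b k 0 s) \<partial>lborel))"
    using assms by (simp add: mult.assoc [symmetric] ennreal_mult' [symmetric])
  also have "\<dots> = ennreal (Gamma (k + 1) / b powr (k + 1))"
    unfolding * [symmetric] using assms by (simp add: ennreal_mult' [symmetric])
  finally show ?thesis .
qed

lemma gig_weight_0_has_bochner_integral:
  assumes "b > 0" "k > -1"
  shows "has_bochner_integral lborel (gig_weight b k 0) (Gamma (k + 1) / b powr (k + 1))"
  using assms by (intro has_bochner_integral_nn_integral nn_integral_gig_weight_0)
    (auto simp: gig_weight_nonneg Gamma_real_pos less_imp_le)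

text \<open>A consequence of \<open>(1 + y / n) ^ n \<le> exp y\<close>. With
  \<open>y = c / s\<close> it trades \<open>exp (- (c / s))\<close> for a power of
  \<open>s\<close>.\<close>

lemma power_le_power_mult_exp:
  fixes y :: real
  assumes "y \<ge> 0" "n > 0"
  shows "y ^ n \<le> real n ^ n * exp y"
proof -
  have "(y / n) ^ n \<le> (1 + y / n) ^ n"
    using assms by (intro power_mono) auto
  also have "\<dots> \<le> exp y"
    using assms by (intro exp_ge_one_plus_x_over_n_power_n) auto
  finally show ?thesis
    using assms by (simp add: power_divide divide_simps mult.commute)
qed

lemma gig_weight_factor:
  "gig_weight b k c s = indicator {0<..} s * (s powr k * exp (- b * s)) * exp (- (c / s))"
  by (simp add: gig_weight_def mult_exp_exp algebra_simps)

lemma gig_weight_antimono: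
  assumes "c \<le> d" shows "gig_weight b k d s \<le> gig_weight b k c s"
proof (cases "s > 0")
  case True
  then have "c / s \<le> d / s" using assms by (simp add: divide_right_mono)
  then show ?thesis using True by (simp add: gig_weight_def mult_left_mono)
qed (simp add: gig_weight_def)

text \<open>At infinity \<open>exp (- b * s)\<close> decides, at \<open>0\<close> either
  \<open>k > -1\<close> or the factor \<open>exp (- (c / s))\<close>. The latter is at most
  \<open>(n * s / c) ^ n\<close>, which raises the exponent above \<open>-1\<close> and so reduces
  to the Gamma integral.\<close>

lemma gig_weight_integrable:
  assumes "b > 0" "c \<ge> 0" "c > 0 \<or> k > -1"
  shows "integrable lborel (gig_weight b k c)"
proof (cases "k > -1")
  case True
  have "integrable lborel (gig_weight b k 0)"
    using gig_weight_0_has_bochner_integral[OF assms(1) True] by (simp add: has_bochner_integral_iff)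
  then show ?thesis
    by (rule Bochner_Integration.integrable_bound)
      (use gig_weight_antimono[OF assms(2)] in \<open>auto simp: gig_weight_nonneg\<close>)
next
  case False
  with assms have c: "c > 0" by simp
  \<comment> \<open>Here \<open>k \<le> -1\<close>, so \<open>n \<ge> 1\<close>, and rounding up
    gives \<open>k + n \<ge> 0\<close>.\<close>
  define n where "n = nat \<lceil>-k\<rceil>"
  have n: "n > 0" "k + real n > -1" unfolding n_def using False by linarith+
  have "integrable lborel (\<lambda>s. (n / c) ^ n * gig_weight b (k + n) 0 s)"
    using gig_weight_0_has_bochner_integral[OF assms(1) n(2)]
    by (intro integrable_mult_right) (simp add: has_bochner_integral_iff)
  then show ?thesis
  proof (rule Bochner_Integration.integrable_bound)
    show "AE s in lborel. norm (gig_weight b k c s) \<le> norm ((n / c) ^ n * gig_weight b (k + n) 0 s)"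
    proof (rule AE_I2)
      fix s :: real
      show "norm (gig_weight b k c s) \<le> norm ((n / c) ^ n * gig_weight b (k + n) 0 s)"
      proof (cases "s > 0")
        case True
        have "c ^ n > 0" "s ^ n > 0" using c True by auto
        then have "exp (- (c / s)) \<le> (n * s / c) ^ n"
          using power_le_power_mult_exp[of "c / s" n] n c True
          by (simp add: power_divide power_mult_distrib exp_minus field_simps)
        then have "s powr k * exp (- (b * s)) * exp (- (c / s))
            \<le> s powr k * exp (- (b * s)) * (n * s / c) ^ n"
          by (intro mult_left_mono) auto
        moreover have "gig_weight b k c s = s powr k * exp (- (b * s)) * exp (- (c / s))"
          using True by (simp add: gig_weight_factor)
        moreover have "(n / c) ^ n * gig_weight b (k + n) 0 s = s powr k * exp (- (b * s)) * (n * s / c) ^ n"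
          using True by (simp add: gig_weight_factor powr_add powr_realpow power_divide power_mult_distrib)
        ultimately have "gig_weight b k c s \<le> (n / c) ^ n * gig_weight b (k + n) 0 s"
          by simp
        then show ?thesis
          by (smt (verit) gig_weight_nonneg real_norm_def)
      qed (simp add: gig_weight_def)
    qed
  qed simp
qed

section \<open>Differentiation and continuity in \<open>c\<close>\<close>

lemma exp_neg_diff_le:
  fixes u v w :: real
  assumes "w \<le> u" "w \<le> v"
  shows "\<bar>exp (- u) - exp (- v)\<bar> \<le> \<bar>u - v\<bar> * exp (- w)"
proof -
  have *: "\<bar>exp (- u) - exp (- v)\<bar> \<le> \<bar>u - v\<bar> * exp (- w)" if "w \<le> u" "u \<le> v" for u v :: real
  proof -
    have "exp (- u) - exp (- v) = (1 - exp (u - v)) * exp (- u)"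
      by (simp add: left_diff_distrib mult_exp_exp)
    also have "\<dots> \<le> (v - u) * exp (- u)"
      by (intro mult_right_mono) (use exp_ge_add_one_self[of "u - v"] in linarith, simp)
    also have "\<dots> \<le> (v - u) * exp (- w)"
      using that by (intro mult_left_mono) auto
    finally show ?thesis using that by simp
  qed
  show ?thesis
    using *[of u v] *[of v u] assms by (cases "u \<le> v") (auto simp: abs_minus_commute)
qed

text \<open>Differentiation under the integral brings down \<open>- 1 / s\<close>. The one-sided
  form is there because \<open>c = x\<^sup>2 / 4\<close> meets the end point \<open>0\<close> at
  \<open>x = 0\<close>; then \<open>k > 0\<close> makes the weight of exponent \<open>k - 1\<close>
  integrable.\<close>

lemma gig_integral_has_derivative:
  assumes "b > 0" "c \<ge> 0" "c > 0 \<or> k > 0"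
  shows "(gig_integral b k has_real_derivative - gig_integral b (k - 1) c) (at c within {0..})"
proof -
  have int: "integrable lborel (gig_weight b k d)" if "d \<ge> c / 2" for d
    using assms that by (intro gig_weight_integrable) auto
  \<comment> \<open>Keeping the arguments above \<open>c / 2\<close> gives all difference quotients
    the majorant \<open>gig_weight b (k - 1) (c / 2)\<close>; for \<open>c = 0\<close> nothing is
    lost.\<close>
  have "(gig_integral b k has_real_derivative - gig_integral b (k - 1) c) (at c within {c/2..})"
    unfolding has_field_derivative_iff tendsto_at_iff_sequentially
  proof safe
    fix D :: "nat \<Rightarrow> real"
    assume D: "\<forall>i. D i \<in> {c/2..} - {c}" "D \<longlonglongrightarrow> c"
    have lim: "((\<lambda>d. (exp (- (d / s)) - exp (- (c / s))) / (d - c)) \<longlongrightarrow> - (exp (- (c / s)) / s)) (at c)"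
      if "s > 0" for s
    proof -
      have "((\<lambda>d. exp (- (d / s))) has_real_derivative - (exp (- (c / s)) / s)) (at c)"
        using that by (auto intro!: derivative_eq_intros)
      then show ?thesis by (simp add: has_field_derivative_iff)
    qed
    have filt: "filterlim D (at c) sequentially"
      using D by (auto simp: filterlim_at)
    have w: "(gig_weight b k d s - gig_weight b k c s) / (d - c) =
       indicator {0<..} s * (s powr k * exp (- b * s)) * ((exp (- (d / s)) - exp (- (c / s))) / (d - c))" for d s
      by (simp add: gig_weight_factor right_diff_distrib diff_divide_distrib)
    have w': "gig_weight b (k - 1) c' s = indicator {0<..} s * (s powr k * exp (- b * s)) * (exp (- (c' / s)) / s)"
      for s c'
      by (auto simp: gig_weight_factor powr_diff indicator_def)
    have "(\<lambda>i. LBINT s. (gig_weight b k (D i) s - gig_weight b k c s) / (D i - c))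
        \<longlonglongrightarrow> (LBINT s. - gig_weight b (k - 1) c s)"
    proof (rule integral_dominated_convergence)
      show "integrable lborel (gig_weight b (k - 1) (c / 2))"
        using assms by (intro gig_weight_integrable) auto
      show "AE s in lborel. (\<lambda>i. (gig_weight b k (D i) s - gig_weight b k c s) / (D i - c))
          \<longlonglongrightarrow> - gig_weight b (k - 1) c s"
      proof (rule AE_I2)
        fix s :: real
        show "(\<lambda>i. (gig_weight b k (D i) s - gig_weight b k c s) / (D i - c))
          \<longlonglongrightarrow> - gig_weight b (k - 1) c s"
        proof (cases "s > 0")
          case True
          show ?thesis
            using tendsto_mult_left[OF filterlim_compose[OF lim[OF True] filt]]
            unfolding w w' by simp
        qed (simp add: gig_weight_def)
      qed
      fix i
      show "AE s in lborel. norm ((gig_weight b k (D i) s - gig_weight b k c s) / (D i - c))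
          \<le> gig_weight b (k - 1) (c / 2) s"
      proof (rule AE_I2)
        fix s :: real
        show "norm ((gig_weight b k (D i) s - gig_weight b k c s) / (D i - c))
          \<le> gig_weight b (k - 1) (c / 2) s"
        proof (cases "s > 0")
          case True
          have Di: "D i \<ge> c / 2" "D i \<noteq> c" using D(1)[rule_format, of i] by auto
          \<comment> \<open>Mean value estimate: both exponents are at least
            \<open>c / 2 / s\<close>.\<close>
          have "\<bar>exp (- (D i / s)) - exp (- (c / s))\<bar> \<le> \<bar>D i / s - c / s\<bar> * exp (- (c / 2 / s))"
            using True Di assms by (intro exp_neg_diff_le divide_right_mono) auto
          also have "\<bar>D i / s - c / s\<bar> = \<bar>D i - c\<bar> / s"
            using True by (simp flip: diff_divide_distrib)
          finally have "\<bar>exp (- (D i / s)) - exp (- (c / s))\<bar> / \<bar>D i - c\<bar> \<le> exp (- (c / 2 / s)) / s"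
            using Di True by (simp add: field_simps)
          then have "indicator {0<..} s * (s powr k * exp (- b * s)) *
              (\<bar>exp (- (D i / s)) - exp (- (c / s))\<bar> / \<bar>D i - c\<bar>)
              \<le> gig_weight b (k - 1) (c / 2) s"
            unfolding w' by (intro mult_left_mono) auto
          then show ?thesis
            unfolding w by (simp add: abs_mult)
        qed (simp add: gig_weight_def)
      qed
    qed auto
    then have "(\<lambda>i. (gig_integral b k (D i) - gig_integral b k c) / (D i - c)) \<longlonglongrightarrow> - gig_integral b (k - 1) c"
      using D(1) assms unfolding gig_integral_def
      by (simp add: int Bochner_Integration.integral_diff)
    then show "((\<lambda>y. (gig_integral b k y - gig_integral b k c) / (y - c)) \<circ> D) \<longlonglongrightarrow> - gig_integral b (k - 1) c"
      by (simp add: comp_def)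
  qed
  then show ?thesis
  proof (cases "c = 0")
    case False
    then have "at c within {c/2..} = at c"
      using assms by (intro at_within_interior) auto
    moreover assume "(gig_integral b k has_real_derivative - gig_integral b (k - 1) c) (at c within {c/2..})"
    ultimately show ?thesis
      by (metis has_field_derivative_at_within)
  qed simp
qed

text \<open>The weight at \<open>c = 0\<close> is a majorant. This covers the end point also for
  \<open>-1 < k \<le> 0\<close>, where the derivative formula does not apply.\<close>

lemma gig_integral_continuous_0:
  assumes "b > 0" "k > -1"
  shows "(gig_integral b k \<longlongrightarrow> gig_integral b k 0) (at 0 within {0..})"
  unfolding tendsto_at_iff_sequentially
proof safe
  fix D :: "nat \<Rightarrow> real"
  assume D: "\<forall>i. D i \<in> {0..} - {0}" "D \<longlonglongrightarrow> 0"
  have "(\<lambda>i. LBINT s. gig_weight b k (D i) s) \<longlonglongrightarrow> (LBINT s. gig_weight b k 0 s)"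
  proof (rule integral_dominated_convergence)
    show "integrable lborel (gig_weight b k 0)"
      using assms by (intro gig_weight_integrable) auto
    show "AE s in lborel. (\<lambda>i. gig_weight b k (D i) s) \<longlonglongrightarrow> gig_weight b k 0 s"
      by (rule AE_I2) (auto simp: gig_weight_def indicator_def intro!: tendsto_eq_intros D)
    show "AE s in lborel. norm (gig_weight b k (D i) s) \<le> gig_weight b k 0 s" for i
      using gig_weight_antimono[of 0 "D i"] D(1)[rule_format, of i] by (auto simp: gig_weight_nonneg)
  qed auto
  then show "(gig_integral b k \<circ> D) \<longlonglongrightarrow> gig_integral b k 0"
    by (simp add: comp_def gig_integral_def)
qed

text \<open>This is the recurrence of the Bessel functions K of orders \<open>k\<close>,
  \<open>k + 1\<close>, \<open>k + 2\<close>. The boundary terms vanish for every \<open>k\<close>: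
  \<open>exp (- (c / s))\<close> handles \<open>s = 0\<close> and \<open>exp (- b * s)\<close>
  infinity.\<close>

lemma gig_integral_recurrence:
  assumes "b > 0" "c > 0"
  shows "(k + 1) * gig_integral b k c + c * gig_integral b (k - 1) c - b * gig_integral b (k + 1) c = 0"
proof -
  \<comment> \<open>The exponent \<open>k + 1\<close> makes the three terms of the derivative carry
    exponents \<open>k\<close>, \<open>k - 1\<close> and \<open>k + 1\<close>.\<close>
  define F where "F s = s powr (k + 1) * exp (- (c / s) - b * s)" for s
  define f where "f s = (k + 1) * (s powr k * exp (- (c / s) - b * s))
     + c * (s powr (k - 1) * exp (- (c / s) - b * s))
     - b * (s powr (k + 1) * exp (- (c / s) - b * s))" for s
  have eq: "indicator {0<..} s * f s = (k + 1) * gig_weight b k c s + c * gig_weight b (k - 1) c s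
      - b * gig_weight b (k + 1) c s" for s
    by (simp add: f_def gig_weight_def algebra_simps)
  have int: "integrable lborel (gig_weight b j c)" for j
    using assms by (intro gig_weight_integrable) auto
  have F0: "(F \<longlongrightarrow> 0) (at_right 0)" unfolding F_def using assms by real_asymp
  have Finf: "(F \<longlongrightarrow> 0) at_top" unfolding F_def using assms by real_asymp
  have ein: "einterval 0 \<infinity> = {0<..}" by (auto simp: einterval_def zero_ereal_def)
  have "(LBINT s=0..\<infinity>. f s) = 0 - 0"
  proof (rule interval_integral_FTC_integrable)
    fix s assume "0 < ereal s"
    then have s: "s > 0" by simp
    show "(F has_vector_derivative f s) (at s)"
    proof -
      have "((\<lambda>s. exp (- (c / s) - b * s)) has_real_derivative exp (- (c / s) - b * s) * (c / s ^ 2 - b)) (at s)"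
        using s by (auto intro!: derivative_eq_intros simp: power2_eq_square)
      from DERIV_mult[OF has_real_derivative_powr[OF s, of "k + 1"] this] show ?thesis
        unfolding has_real_derivative_iff_has_vector_derivative [symmetric] F_def f_def
        by (rule DERIV_cong) (use s in \<open>simp add: powr_diff powr_add power2_eq_square field_simps\<close>)
    qed
    show "isCont f s" unfolding f_def using s by (auto intro!: continuous_intros)
  next
    show "set_integrable lborel (einterval 0 \<infinity>) f"
      unfolding set_integrable_def ein by (simp add: eq int)
    show "((F \<circ> real_of_ereal) \<longlongrightarrow> 0) (at_right 0)"
      using F0 by (simp add: zero_ereal_def ereal_tendsto_simps)
    show "((F \<circ> real_of_ereal) \<longlongrightarrow> 0) (at_left \<infinity>)"
      using Finf by (simp add: ereal_tendsto_simps)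
  qed simp
  then have "(LBINT s. indicator {0<..} s * f s) = 0"
    by (simp add: interval_lebesgue_integral_def set_lebesgue_integral_def ein)
  then show ?thesis
    unfolding eq gig_integral_def by (simp add: int)
qed

section \<open>The Variance Gamma density\<close>

lemma heat_density_nonneg: "s > 0 \<Longrightarrow> heat_density s x \<ge> 0"
  by (simp add: heat_density_def)

lemma heat_density_measurable [measurable]:
  assumes [measurable]: "f \<in> borel_measurable M" "g \<in> borel_measurable M"
  shows "(\<lambda>z. heat_density (f z) (g z)) \<in> borel_measurable M"
  unfolding heat_density_def by measurable

lemma gamma_sub_density_measurable [measurable]: "gamma_sub_density a b t \<in> borel_measurable borel"
  unfolding gamma_sub_density_def by measurable

lemma gamma_sub_density_nonneg: "a > 0 \<Longrightarrow> t > 0 \<Longrightarrow> gamma_sub_density a b t s \<ge> 0"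
  by (auto simp: gamma_sub_density_def Gamma_real_pos less_imp_le)

lemma heat_density_eq_normal_density:
  "s > 0 \<Longrightarrow> heat_density s = normal_density 0 (sqrt (2 * s))"
  by (rule ext) (simp add: heat_density_def normal_density_def)

lemma heat_density_has_bochner_integral:
  "s > 0 \<Longrightarrow> has_bochner_integral lborel (heat_density s) 1"
  using integrable_normal_density[of "sqrt (2 * s)" 0] integral_normal_density[of "sqrt (2 * s)" 0]
  by (simp add: has_bochner_integral_iff heat_density_eq_normal_density)

text \<open>Scaling by the standard deviation \<open>sqrt (2 * s)\<close> reduces to the standard
  normal law.\<close>

lemma heat_density_char:
  assumes "s > 0"
  shows "(CLBINT x. heat_density s x *\<^sub>R iexp (u * x)) = exp (- s * u\<^sup>2)"
proof -
  define \<sigma> where "\<sigma> = sqrt (2 * s)"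
  have \<sigma>: "\<sigma> > 0" "\<sigma>\<^sup>2 = 2 * s" using assms by (auto simp: \<sigma>_def)
  have "(CLBINT x. heat_density s x *\<^sub>R iexp (u * x)) =
      \<bar>\<sigma>\<bar> *\<^sub>R (CLBINT y. heat_density s (0 + \<sigma> * y) *\<^sub>R iexp (u * (0 + \<sigma> * y)))"
    using \<sigma> by (intro lborel_integral_real_affine) auto
  also have "\<dots> = (CLBINT y. std_normal_density y *\<^sub>R iexp (u * \<sigma> * y))"
    unfolding integral_scaleR_right [symmetric] scaleR_scaleR
  proof (intro Bochner_Integration.integral_cong refl arg_cong2[of _ _ _ _ "(*\<^sub>R)"])
    fix y
    show "\<bar>\<sigma>\<bar> * heat_density s (0 + \<sigma> * y) = std_normal_density y"
      using \<sigma> assms by (simp add: heat_density_def std_normal_density_def power_mult_distrib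
          real_sqrt_mult \<sigma>_def field_simps)
  qed (simp add: mult_ac)
  also have "\<dots> = char std_normal_distribution (u * \<sigma>)"
    unfolding char_def by (subst integral_density) (auto simp: normal_density_nonneg)
  also have "\<dots> = exp (- s * u\<^sup>2)"
    using \<sigma> by (simp add: char_std_normal_distribution power_mult_distrib mult.commute)
  finally show ?thesis .
qed

text \<open>The factor \<open>exp (- l * s)\<close> only changes the rate \<open>b\<close> into
  \<open>b + l\<close>. The case \<open>l = 0\<close> is included for the total mass.\<close>

lemma gamma_sub_density_laplace:
  assumes "a > 0" "b > 0" "t > 0" "l \<ge> 0"
  shows "has_bochner_integral lborel (\<lambda>s. gamma_sub_density a b t s * exp (- l * s)) (exp (- t * a * ln (1 + l / b)))"
proof -
  have "has_bochner_integral lborel (\<lambda>s. b powr (a * t) / Gamma (a * t) * gig_weight (b + l) (a * t - 1) 0 s)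
     (b powr (a * t) / Gamma (a * t) * (Gamma (a * t - 1 + 1) / (b + l) powr (a * t - 1 + 1)))"
    using assms by (intro has_bochner_integral_mult_right gig_weight_0_has_bochner_integral) auto
  moreover have "gamma_sub_density a b t s * exp (- l * s) = b powr (a * t) / Gamma (a * t) * gig_weight (b + l) (a * t - 1) 0 s" for s
    by (simp add: gamma_sub_density_def gig_weight_def algebra_simps mult_exp_exp)
  moreover have "b powr (a * t) / Gamma (a * t) * (Gamma (a * t - 1 + 1) / (b + l) powr (a * t - 1 + 1))
     = exp (- t * a * ln (1 + l / b))"
  proof -
    have "1 + l / b = (b + l) / b" using assms by (simp add: add_divide_distrib)
    then have *: "ln (1 + l / b) = ln (b + l) - ln b" using assms by (simp add: ln_div)
    have "Gamma (a * t) > 0" using assms by (simp add: Gamma_real_pos)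
    then have "b powr (a * t) / Gamma (a * t) * (Gamma (a * t - 1 + 1) / (b + l) powr (a * t - 1 + 1)) = b powr (a * t) / (b + l) powr (a * t)"
      by simp
    also have "\<dots> = exp (- t * a * ln (1 + l / b))"
      unfolding * using assms by (simp add: powr_def exp_diff [symmetric] algebra_simps)
    finally show ?thesis .
  qed
  ultimately show ?thesis by (simp only:)
qed

lemma vg_density_eq_integral:
  "vg_density a b t x = (LBINT s. heat_density s x * gamma_sub_density a b t s)"
  unfolding vg_density_def set_lebesgue_integral_def
  by (intro Bochner_Integration.integral_cong) (auto simp: gamma_sub_density_def)

definition vg_const :: "real \<Rightarrow> real \<Rightarrow> real \<Rightarrow> real" where
  "vg_const a b t = b powr (a * t) / (Gamma (a * t) * (2 * sqrt pi))"

text \<open>Half a power of \<open>s\<close> from \<open>sqrt (4 * pi * s)\<close> turns the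
  exponent \<open>a * t - 1\<close> into \<open>a * t - 3 / 2\<close>. The integrands agree
  pointwise, so the identity holds also where the integrals diverge and count as
  \<open>0\<close>.\<close>

lemma vg_density_eq_gig_integral:
  "vg_density a b t x = vg_const a b t * gig_integral b (a * t - 3 / 2) (x\<^sup>2 / 4)"
  unfolding vg_const_def vg_density_eq_integral gig_integral_def integral_mult_right_zero [symmetric]
proof (intro Bochner_Integration.integral_cong refl)
  fix s :: real
  show "heat_density s x * gamma_sub_density a b t s =
      b powr (a * t) / (Gamma (a * t) * (2 * sqrt pi)) * gig_weight b (a * t - 3 / 2) (x\<^sup>2 / 4) s"
  proof (cases "s > 0")
    case True
    have "s powr (a * t - 1) = s powr (a * t - 3 / 2) * sqrt s"
      using True by (simp add: powr_half_sqrt [symmetric] powr_add [symmetric])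
    then show ?thesis using True
      by (simp add: heat_density_def gamma_sub_density_def gig_weight_factor real_sqrt_mult mult_ac)
  qed (simp add: gamma_sub_density_def gig_weight_def)
qed

section \<open>Integrability and characteristic function of the density\<close>

lemma vg_density_nonneg:
  assumes "a > 0" "t > 0" shows "vg_density a b t x \<ge> 0"
  unfolding vg_density_def set_lebesgue_integral_def using assms
  by (intro integral_nonneg_AE AE_I2)
    (auto simp: indicator_def heat_density_nonneg gamma_sub_density_nonneg)

lemma vg_density_measurable [measurable]: "vg_density a b t \<in> borel_measurable borel"
  unfolding vg_density_eq_integral [abs_def]
  by measurable

text \<open>Tonelli with \<open>x\<close> integrated first: the heat and Gamma densities both have
  mass one. This justifies the later exchange of integrals in the characteristic function.\<close>

lemma vg_joint_integrable:
  assumes "a > 0" "b > 0" "t > 0"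
  shows "integrable (lborel \<Otimes>\<^sub>M lborel) (\<lambda>(x, s). heat_density s x * gamma_sub_density a b t s)"
proof (rule integrableI_nonneg)
  show [measurable]: "(\<lambda>(x, s). heat_density s x * gamma_sub_density a b t s) \<in> borel_measurable (lborel \<Otimes>\<^sub>M lborel)"
    by (simp add: split_beta')
  have nonneg: "heat_density s x * gamma_sub_density a b t s \<ge> 0" for s x
    using assms by (cases "s > 0") (auto simp: gamma_sub_density_nonneg heat_density_nonneg gamma_sub_density_def[of _ _ _ s])
  show "AE z in lborel \<Otimes>\<^sub>M lborel. 0 \<le> (case z of (x, s) \<Rightarrow> heat_density s x * gamma_sub_density a b t s)"
    using nonneg by (intro AE_I2) auto
  have "(\<integral>\<^sup>+z. ennreal (case z of (x, s) \<Rightarrow> heat_density s x * gamma_sub_density a b t s) \<partial>(lborel \<Otimes>\<^sub>M lborel))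
      = (\<integral>\<^sup>+s. (\<integral>\<^sup>+x. ennreal (heat_density s x * gamma_sub_density a b t s) \<partial>lborel) \<partial>lborel)"
    by (subst lborel_pair.nn_integral_snd [symmetric]) auto
  also have "\<dots> = (\<integral>\<^sup>+s. ennreal (gamma_sub_density a b t s) \<partial>lborel)"
  proof (rule nn_integral_cong)
    fix s :: real
    show "(\<integral>\<^sup>+x. ennreal (heat_density s x * gamma_sub_density a b t s) \<partial>lborel) = ennreal (gamma_sub_density a b t s)"
    proof (cases "s > 0")
      case True
      have "(\<integral>\<^sup>+x. ennreal (heat_density s x) \<partial>lborel) = 1"
        using heat_density_has_bochner_integral[OF True] True
        by (subst nn_integral_eq_integral) (auto simp: has_bochner_integral_iff heat_density_nonneg)
      then show ?thesis
        using True assms by (simp add: ennreal_mult heat_density_nonneg gamma_sub_density_nonneg nn_integral_multc)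
    qed (simp add: gamma_sub_density_def)
  qed
  also have "\<dots> = ennreal 1"
    using gamma_sub_density_laplace[of a b t 0] assms
    by (subst nn_integral_eq_integral) (auto simp: has_bochner_integral_iff gamma_sub_density_nonneg)
  finally show "(\<integral>\<^sup>+z. ennreal (case z of (x, s) \<Rightarrow> heat_density s x * gamma_sub_density a b t s) \<partial>(lborel \<Otimes>\<^sub>M lborel)) < \<infinity>"
    by simp
qed

lemma vg_density_integrable:
  assumes "a > 0" "b > 0" "t > 0"
  shows "integrable lborel (vg_density a b t)"
  using lborel_pair.integrable_fst'[OF vg_joint_integrable[OF assms]]
  by (simp add: vg_density_eq_integral [abs_def])

text \<open>After exchanging integrals the inner one is the Gaussian characteristic function
  \<open>exp (- s * u\<^sup>2)\<close> and the outer one the Laplace transform of the Gamma density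
  at \<open>u\<^sup>2\<close>.\<close>

lemma vg_density_char:
  assumes "a > 0" "b > 0" "t > 0"
  shows "(CLBINT x. vg_density a b t x *\<^sub>R iexp (u * x)) = exp (- t * a * ln (1 + u\<^sup>2 / b))"
proof -
  have int: "integrable (lborel \<Otimes>\<^sub>M lborel)
      (\<lambda>(x, s). (heat_density s x * gamma_sub_density a b t s) *\<^sub>R iexp (u * x))"
    by (rule Bochner_Integration.integrable_bound[OF vg_joint_integrable[OF assms]])
      (auto simp: split_beta' abs_mult)
  have "(CLBINT x. vg_density a b t x *\<^sub>R iexp (u * x)) =
      (CLBINT x. CLBINT s. (heat_density s x * gamma_sub_density a b t s) *\<^sub>R iexp (u * x))"
  proof (rule Bochner_Integration.integral_cong [OF refl])
    fix x
    show "vg_density a b t x *\<^sub>R iexp (u * x) = (CLBINT s. (heat_density s x * gamma_sub_density a b t s) *\<^sub>R iexp (u * x))"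
      unfolding vg_density_eq_integral scaleR_conv_of_real
      by (simp del: of_real_mult)
  qed
  also have "\<dots> = (CLBINT s. CLBINT x. (heat_density s x * gamma_sub_density a b t s) *\<^sub>R iexp (u * x))"
    using lborel_pair.Fubini_integral[OF int] by simp
  also have "\<dots> = (CLBINT s. of_real (gamma_sub_density a b t s * exp (- u\<^sup>2 * s)))"
  proof (rule Bochner_Integration.integral_cong [OF refl])
    fix s
    show "(CLBINT x. (heat_density s x * gamma_sub_density a b t s) *\<^sub>R iexp (u * x)) = of_real (gamma_sub_density a b t s * exp (- u\<^sup>2 * s))"
    proof (cases "s > 0")
      case True
      have "(CLBINT x. (heat_density s x * gamma_sub_density a b t s) *\<^sub>R iexp (u * x)) =
          gamma_sub_density a b t s *\<^sub>R (CLBINT x. heat_density s x *\<^sub>R iexp (u * x))"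
        unfolding integral_scaleR_right [symmetric] scaleR_scaleR by (simp only: mult.commute)
      then show ?thesis
        unfolding heat_density_char[OF True] by (simp add: scaleR_conv_of_real mult.commute)
    qed (simp add: gamma_sub_density_def)
  qed
  also have "\<dots> = of_real (exp (- t * a * ln (1 + u\<^sup>2 / b)))"
    using gamma_sub_density_laplace[OF assms, of "u\<^sup>2"] 
    by (subst integral_complex_of_real) (simp add: has_bochner_integral_iff)
  finally show ?thesis .
qed

lemma real_distribution_vg:
  assumes "a > 0" "b > 0" "t > 0"
  shows "real_distribution (density lborel (\<lambda>x. ennreal (vg_density a b t x)))"
proof -
  \<comment> \<open>The total mass is the characteristic function at \<open>0\<close>.\<close>
  have "(CLBINT x. vg_density a b t x *\<^sub>R iexp (0 * x)) = of_real (LBINT x. vg_density a b t x)"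
    by (subst integral_complex_of_real [symmetric]) (simp add: scaleR_conv_of_real)
  then have "(LBINT x. vg_density a b t x) = 1"
    using vg_density_char[OF assms, of 0] by simp
  then have "(\<integral>\<^sup>+x. ennreal (vg_density a b t x) \<partial>lborel) = 1"
    using vg_density_integrable[OF assms] assms
    by (subst nn_integral_eq_integral) (auto simp: vg_density_nonneg)
  then have "prob_space (density lborel (\<lambda>x. ennreal (vg_density a b t x)))"
    by (intro prob_spaceI) (simp add: emeasure_density)
  then show ?thesis
    by (simp add: real_distribution_def real_distribution_axioms_def)
qed

lemma char_vg:
  assumes "a > 0" "b > 0" "t > 0"
  shows "char (density lborel (\<lambda>x. ennreal (vg_density a b t x))) u = exp (- t * a * ln (1 + u\<^sup>2 / b))"
  unfolding char_def using vg_density_char[OF assms, of u] assms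
  by (subst integral_density) (auto simp: vg_density_nonneg)

section \<open>The differential equation\<close>

text \<open>Chain rule with \<open>x\<^sup>2 / 4\<close>, whose range lies in \<open>{0..}\<close>;
  hence the one-sided derivative at \<open>c = 0\<close> yields a two-sided one at
  \<open>x = 0\<close>.\<close>

lemma gig_integral_square_has_derivative:
  assumes "b > 0" "x \<noteq> 0 \<or> k > 0"
  shows "((\<lambda>x. gig_integral b k (x\<^sup>2 / 4)) has_real_derivative - (x / 2) * gig_integral b (k - 1) (x\<^sup>2 / 4)) (at x)"
proof -
  have "(gig_integral b k has_real_derivative - gig_integral b (k - 1) (x\<^sup>2 / 4)) (at (x\<^sup>2 / 4) within {0..})"
    using assms by (intro gig_integral_has_derivative) auto
  then have "(gig_integral b k has_real_derivative - gig_integral b (k - 1) (x\<^sup>2 / 4))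
      (at (x\<^sup>2 / 4) within range (\<lambda>x. x\<^sup>2 / 4))"
    by (rule DERIV_subset) auto
  moreover have "((\<lambda>x. x\<^sup>2 / 4) has_real_derivative x / 2) (at x)"
    by (auto intro!: derivative_eq_intros)
  ultimately have "(gig_integral b k \<circ> (\<lambda>x. x\<^sup>2 / 4) has_real_derivative - gig_integral b (k - 1) (x\<^sup>2 / 4) * (x / 2)) (at x)"
    by (rule DERIV_image_chain)
  then show ?thesis by (simp add: comp_def mult.commute)
qed

lemma isCont_gig_integral_square:
  assumes "b > 0" "k > -1"
  shows "isCont (\<lambda>x. gig_integral b k (x\<^sup>2 / 4)) x"
proof (cases "x = 0")
  case True
  have "filterlim (\<lambda>x::real. x\<^sup>2 / 4) (at 0 within {0..}) (at 0)"
    unfolding filterlim_at by (auto intro!: tendsto_eq_intros simp: eventually_at_filter)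
  from filterlim_compose[OF gig_integral_continuous_0[OF assms] this] show ?thesis
    by (simp add: isCont_def True)
qed (use DERIV_isCont gig_integral_square_has_derivative assms in blast)

text \<open>The factor \<open>x\<close> buys half a power of \<open>s\<close> uniformly in
  \<open>x\<close>, since \<open>y * exp (- (y\<^sup>2 / 4))\<close> is bounded in
  \<open>y = \<bar>x\<bar> / sqrt s\<close>.\<close>

lemma mult_gig_weight_bound:
  "\<bar>x * gig_weight b k (x\<^sup>2 / 4) s\<bar> \<le> gig_weight b (k + 1 / 2) 0 s"
proof (cases "s > 0")
  case True
  define y where "y = \<bar>x\<bar> / sqrt s"
  have y2: "y\<^sup>2 = x\<^sup>2 / s" using True by (simp add: y_def power_divide)
  \<comment> \<open>This is \<open>(y / 2 - 1)\<^sup>2 \<ge> 0\<close>.\<close>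
  have "y \<le> 1 + y\<^sup>2 / 4"
    using sum_squares_ge_zero[of "y / 2 - 1" 0] by (simp add: power2_eq_square algebra_simps)
  also have "\<dots> \<le> exp (y\<^sup>2 / 4)" by (rule exp_ge_add_one_self)
  finally have "y * exp (- (y\<^sup>2 / 4)) \<le> 1" by (simp add: exp_minus divide_simps)
  then have "\<bar>x\<bar> * exp (- (x\<^sup>2 / 4 / s)) \<le> sqrt s"
    unfolding y2 y_def using True by (simp add: field_simps)
  then have "s powr k * exp (- b * s) * (\<bar>x\<bar> * exp (- (x\<^sup>2 / 4 / s))) \<le> s powr k * exp (- b * s) * sqrt s"
    by (intro mult_left_mono) auto
  then show ?thesis
    using True by (simp add: gig_weight_factor abs_mult powr_add powr_half_sqrt mult_ac)
qed (simp add: gig_weight_def)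

text \<open>The extra factor lowers the threshold from \<open>-1\<close> to \<open>-3/2\<close>,
  which the exponent \<open>a * t - 3 / 2\<close> of the density clears at every positive time. At
  \<open>x = 0\<close> the product is \<open>0\<close> whatever value the integral has.\<close>

lemma isCont_mult_gig_integral_square:
  assumes "b > 0" "k > -3/2"
  shows "isCont (\<lambda>x. x * gig_integral b k (x\<^sup>2 / 4)) x"
proof (cases "x = 0")
  case False
  have "isCont (\<lambda>x. gig_integral b k (x\<^sup>2 / 4)) x"
    by (rule DERIV_isCont[OF gig_integral_square_has_derivative]) (use False assms in auto)
  then show ?thesis by (intro continuous_intros)
next
  case True
  have "((\<lambda>x. x * gig_integral b k (x\<^sup>2 / 4)) \<longlongrightarrow> 0) (at 0)"
    unfolding tendsto_at_iff_sequentially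
  proof safe
    fix D :: "nat \<Rightarrow> real"
    assume D: "\<forall>i. D i \<in> UNIV - {0}" "D \<longlonglongrightarrow> 0"
    have "(\<lambda>i. LBINT s. D i * gig_weight b k ((D i)\<^sup>2 / 4) s) \<longlonglongrightarrow> (LBINT s::real. (0::real))"
    proof (rule integral_dominated_convergence)
      show "integrable lborel (gig_weight b (k + 1 / 2) 0)"
        using assms by (intro gig_weight_integrable) auto
      show "AE s in lborel. (\<lambda>i. D i * gig_weight b k ((D i)\<^sup>2 / 4) s) \<longlonglongrightarrow> 0"
        by (rule AE_I2) (auto simp: gig_weight_def indicator_def intro!: tendsto_eq_intros D)
      show "AE s in lborel. norm (D i * gig_weight b k ((D i)\<^sup>2 / 4) s) \<le> gig_weight b (k + 1 / 2) 0 s" for i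
        using mult_gig_weight_bound by simp
    qed auto
    then show "((\<lambda>x. x * gig_integral b k (x\<^sup>2 / 4)) \<circ> D) \<longlonglongrightarrow> 0"
      by (simp add: comp_def gig_integral_def)
  qed
  then show ?thesis by (simp add: isCont_def True)
qed

lemma integrable_mult_continuous_compact_support:
  fixes p f :: "real \<Rightarrow> real"
  assumes "integrable lborel p" "continuous_on UNIV f" "\<And>x. R < \<bar>x\<bar> \<Longrightarrow> f x = 0"
  shows "integrable lborel (\<lambda>x. p x * f x)"
proof -
  have "compact (f ` {-R..R})"
    using assms(2) by (intro compact_continuous_image) (auto intro: continuous_on_subset)
  then obtain B where B: "\<And>x. x \<in> {-R..R} \<Longrightarrow> \<bar>f x\<bar> \<le> B"
    using compact_imp_bounded[of "f ` {-R..R}"] unfolding bounded_iff real_norm_def by blast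
  \<comment> \<open>The absolute value of \<open>B\<close> is taken because for \<open>R < 0\<close>
    the interval is empty and \<open>B\<close> arbitrary.\<close>
  have bound: "\<bar>f x\<bar> \<le> \<bar>B\<bar>" for x
  proof (cases "x \<in> {-R..R}")
    case False
    then have "R < \<bar>x\<bar>" by auto
    then show ?thesis using assms(3) by simp
  qed (use B[of x] in linarith)
  have [measurable]: "f \<in> borel_measurable borel"
    using assms(2) by (rule borel_measurable_continuous_onI)
  have "integrable lborel (\<lambda>x. p x * \<bar>B\<bar>)" using assms(1) by simp
  then show ?thesis
  proof (rule Bochner_Integration.integrable_bound)
    show "AE x in lborel. norm (p x * f x) \<le> norm (p x * \<bar>B\<bar>)"
      using bound by (auto simp: abs_mult intro!: mult_left_mono)
  qed (use assms(1) in measurable)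
qed

section \<open>The pointwise equation\<close>

lemma vg_density_has_derivative:
  assumes "b > 0" "x \<noteq> 0 \<or> a * t > 3 / 2"
  shows "(vg_density a b t has_real_derivative
     - vg_const a b t * (x / 2 * gig_integral b (a * t - 5 / 2) (x\<^sup>2 / 4))) (at x)"
proof -
  have "((\<lambda>x. gig_integral b (a * t - 3 / 2) (x\<^sup>2 / 4)) has_real_derivative - (x / 2) * gig_integral b (a * t - 3 / 2 - 1) (x\<^sup>2 / 4)) (at x)"
    using assms by (intro gig_integral_square_has_derivative) auto
  from DERIV_cmult[OF this, of "vg_const a b t"] show ?thesis
    by (simp add: vg_density_eq_gig_integral [abs_def])
qed

lemma vg_density_deriv_has_derivative:
  assumes "b > 0" "x \<noteq> 0"
  shows "(deriv (vg_density a b t) has_real_derivative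
     vg_const a b t *
       (x\<^sup>2 / 4 * gig_integral b (a * t - 7 / 2) (x\<^sup>2 / 4) - gig_integral b (a * t - 5 / 2) (x\<^sup>2 / 4) / 2)) (at x)"
proof (rule has_field_derivative_transform_within_open)
  let ?C = "vg_const a b t"
  show "((\<lambda>x. - ?C * (x / 2 * gig_integral b (a * t - 5 / 2) (x\<^sup>2 / 4))) has_real_derivative
      ?C * (x\<^sup>2 / 4 * gig_integral b (a * t - 7 / 2) (x\<^sup>2 / 4) - gig_integral b (a * t - 5 / 2) (x\<^sup>2 / 4) / 2)) (at x)"
    using gig_integral_square_has_derivative[of b x "a * t - 5 / 2"] assms
    by (auto intro!: derivative_eq_intros simp: power2_eq_square field_simps)
  show "- ?C * (y / 2 * gig_integral b (a * t - 5 / 2) (y\<^sup>2 / 4)) = deriv (vg_density a b t) y" if "y \<in> - {0}" for y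
    using vg_density_has_derivative[of b y a t] assms that by (intro DERIV_imp_deriv [symmetric]) auto
qed (use assms in auto)

text \<open>Away from \<open>0\<close> the recurrence at \<open>k = a * t - 5 / 2\<close> eliminates
  the lowest exponent and the rest cancels. For \<open>a * t > 3 / 2\<close> the integral of
  exponent \<open>a * t - 5 / 2\<close> still converges at \<open>0\<close>; there the first
  derivative vanishes and the equation is trivial, so only differentiability has content.\<close>

lemma vg_density_ode:
  assumes "b > 0" "x \<noteq> 0 \<or> a * t > 3 / 2"
  shows "vg_density a b t field_differentiable (at x)"
    and "deriv (vg_density a b t) field_differentiable (at x)"
    and "x * deriv (deriv (vg_density a b t)) x - (2 * a * t - 2) * deriv (vg_density a b t) x
      - b * x * vg_density a b t x = 0"
proof -
  let ?C = "vg_const a b t"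
  let ?G = "\<lambda>k x. gig_integral b k (x\<^sup>2 / 4)"
  note deriv1 = vg_density_has_derivative[OF assms]
  show "vg_density a b t field_differentiable (at x)"
    using deriv1 unfolding field_differentiable_def by blast
  show "deriv (vg_density a b t) field_differentiable (at x)"
  proof (cases "x = 0")
    case False
    then show ?thesis
      using vg_density_deriv_has_derivative assms unfolding field_differentiable_def by blast
  next
    case True
    then have at: "a * t > 3 / 2" using assms by simp
    have "deriv (vg_density a b t) = (\<lambda>y. - ?C * (y / 2 * ?G (a * t - 5 / 2) y))"
      using vg_density_has_derivative[of b _ a t] assms at by (intro ext DERIV_imp_deriv) auto
    moreover have "isCont (?G (a * t - 5 / 2)) 0"
      using assms at by (intro isCont_gig_integral_square) auto
    \<comment> \<open>Caratheodory's form: up to a constant, the difference quotient at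
      \<open>0\<close> is \<open>?G (a * t - 5 / 2)\<close> itself, so its continuity suffices; its
      derivative at \<open>0\<close> need not exist.\<close>
    then have "((\<lambda>y. - ?C * (y / 2 * ?G (a * t - 5 / 2) y)) has_real_derivative - ?C / 2 * ?G (a * t - 5 / 2) 0) (at 0)"
      unfolding CARAT_DERIV
      by (intro exI[of _ "\<lambda>y. - ?C / 2 * ?G (a * t - 5 / 2) y"]) (auto intro!: continuous_intros)
    ultimately show ?thesis
      unfolding True field_differentiable_def by auto
  qed
  show "x * deriv (deriv (vg_density a b t)) x - (2 * a * t - 2) * deriv (vg_density a b t) x
      - b * x * vg_density a b t x = 0"
  proof (cases "x = 0")
    case True
    then show ?thesis using DERIV_imp_deriv[OF deriv1] by simp
  next
    case False
    have rec: "x\<^sup>2 / 4 * ?G (a * t - 7 / 2) x = b * ?G (a * t - 3 / 2) x - (a * t - 3 / 2) * ?G (a * t - 5 / 2) x"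
      using gig_integral_recurrence[of b "x\<^sup>2 / 4" "a * t - 5 / 2"] assms False by simp
    show ?thesis
      unfolding DERIV_imp_deriv[OF deriv1] DERIV_imp_deriv[OF vg_density_deriv_has_derivative[OF assms(1) False]]
        vg_density_eq_gig_integral[of a b t x] rec
      by (simp add: field_simps)
  qed
qed

section \<open>Test functions and the equation in the sense of distributions\<close>

lemma test_function_derivatives:
  assumes "test_function \<phi>"
  shows "((deriv ^^ n) \<phi> has_real_derivative (deriv ^^ Suc n) \<phi> x) (at x)"
  using assms by (simp add: test_function_def DERIV_deriv_iff_field_differentiable)

text \<open>Derivatives of a function vanishing on an open set vanish there, so one radius serves
  all orders.\<close>

lemma test_function_support:
  assumes "test_function \<phi>"
  obtains R where "R > 0" "\<And>n x. R < \<bar>x\<bar> \<Longrightarrow> (deriv ^^ n) \<phi> x = 0"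
proof -
  from assms obtain R where R: "\<And>x. R < \<bar>x\<bar> \<Longrightarrow> \<phi> x = 0"
    unfolding test_function_def by blast
  have "(deriv ^^ n) \<phi> x = 0" if "\<bar>R\<bar> + 1 < \<bar>x\<bar>" for n x
    using that
  proof (induction n arbitrary: x)
    case 0
    then show ?case using R by simp
  next
    case (Suc n)
    have "open {x::real. \<bar>R\<bar> + 1 < \<bar>x\<bar>}" by (intro open_Collect_less continuous_intros)
    then have "((deriv ^^ n) \<phi> has_real_derivative 0) (at x)"
      using Suc by (intro has_field_derivative_transform_within_open[OF DERIV_const[of 0]]) auto
    then show ?case by (simp add: DERIV_imp_deriv)
  qed
  then show ?thesis using that[of "\<bar>R\<bar> + 1"] by simp
qed

text \<open>The bracket is what results when the derivatives are moved from the density to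
  \<open>\<phi>\<close>: the second derivative of \<open>x * \<phi> x\<close> contributes
  \<open>2 * deriv \<phi> x\<close>, which turns \<open>2 * a * t - 2\<close> into
  \<open>2 * a * t\<close>.\<close>

lemma vg_density_weak_ode:
  assumes "a > 0" "b > 0" "t > 0" "test_function \<phi>"
  shows "(LBINT x. vg_density a b t x * (2 * a * t * deriv \<phi> x + x * deriv (deriv \<phi>) x - b * x * \<phi> x)) = 0"
proof -
  let ?C = "vg_const a b t"
  let ?G = "\<lambda>k x. gig_integral b k (x\<^sup>2 / 4)"
  let ?I = "\<lambda>x. vg_density a b t x * (2 * a * t * deriv \<phi> x + x * deriv (deriv \<phi>) x - b * x * \<phi> x)"
  \<comment> \<open>The bracket \<open>x * p' - (2 * a * t - 1) * p\<close> is replaced by its value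
    \<open>- 2 * b * ?C * ?G (a * t - 1 / 2) x\<close>, so \<open>p'\<close> does not occur.\<close>
  define \<Phi> where "\<Phi> x = x * vg_density a b t x * deriv \<phi> x + 2 * b * ?C * ?G (a * t - 1 / 2) x * \<phi> x" for x
  obtain R where R: "R > 0" "\<And>n x. R < \<bar>x\<bar> \<Longrightarrow> (deriv ^^ n) \<phi> x = 0"
    using test_function_support[OF assms(4)] by blast
  note supp = R(2)[of _ 0, simplified] R(2)[of _ "Suc 0", simplified] R(2)[of _ "Suc (Suc 0)", simplified]
  note der = test_function_derivatives[OF assms(4), of 0, simplified]
    test_function_derivatives[OF assms(4), of "Suc 0", simplified]
  have cont: "continuous_on UNIV \<phi>" "continuous_on UNIV (deriv \<phi>)" "continuous_on UNIV (deriv (deriv \<phi>))"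
    using test_function_derivatives[OF assms(4), of 0] test_function_derivatives[OF assms(4), of "Suc 0"]
      test_function_derivatives[OF assms(4), of "Suc (Suc 0)"]
    by (auto intro!: continuous_at_imp_continuous_on DERIV_isCont)
  have int: "integrable lborel ?I"
    using assms cont supp
    by (intro integrable_mult_continuous_compact_support[where R = R] vg_density_integrable)
      (auto intro!: continuous_intros)
  have "(?I has_integral \<Phi> (R + 1) - \<Phi> (- (R + 1))) {- (R + 1)..R + 1}"
  \<comment> \<open>The exceptional point \<open>0\<close> costs only continuity of
    \<open>\<Phi>\<close> there, although the density may be unbounded.\<close>
  proof (rule fundamental_theorem_of_calculus_strong[of "{0}"])
    fix x assume "x \<in> {- (R + 1)..R + 1} - {0}"
    then have x: "x \<noteq> 0" by simp
    \<comment> \<open>One index above the recurrence of the pointwise equation; it rewrites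
      \<open>x * p'\<close>.\<close>
    have rec: "x\<^sup>2 / 4 * ?G (a * t - 5 / 2) x = b * ?G (a * t - 1 / 2) x - (a * t - 1 / 2) * ?G (a * t - 3 / 2) x"
      using gig_integral_recurrence[of b "x\<^sup>2 / 4" "a * t - 3 / 2"] assms x by simp
    have \<Phi>': "(\<Phi> has_real_derivative
        (vg_density a b t x + x * (- ?C * (x / 2 * ?G (a * t - 5 / 2) x))) * deriv \<phi> x
        + x * vg_density a b t x * deriv (deriv \<phi>) x
        + 2 * b * ?C * (- (x / 2) * ?G (a * t - 3 / 2) x) * \<phi> x
        + 2 * b * ?C * ?G (a * t - 1 / 2) x * deriv \<phi> x) (at x)"
      unfolding \<Phi>_def using gig_integral_square_has_derivative[of b x "a * t - 1 / 2"]
        vg_density_has_derivative[of b x a t] der assms x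
      by (auto intro!: derivative_eq_intros)
    have eq: "x * (- ?C * (x / 2 * ?G (a * t - 5 / 2) x)) =
        - 2 * ?C * (b * ?G (a * t - 1 / 2) x - (a * t - 1 / 2) * ?G (a * t - 3 / 2) x)"
      unfolding rec [symmetric] by (simp add: power2_eq_square)
    show "(\<Phi> has_vector_derivative ?I x) (at x)"
      unfolding has_real_derivative_iff_has_vector_derivative [symmetric]
      by (rule DERIV_cong[OF \<Phi>']) (unfold eq, simp add: vg_density_eq_gig_integral algebra_simps)
  next
    \<comment> \<open>For \<open>a * t > 0\<close> both exponents clear their thresholds:
      \<open>a * t - 3 / 2 > -3/2\<close> for the product with \<open>x\<close>, and
      \<open>a * t - 1 / 2 > -1\<close>.\<close>
    have c1: "isCont (\<lambda>x. x * vg_density a b t x) x" for x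
      using isCont_mult[OF continuous_const[of _ ?C] isCont_mult_gig_integral_square[of b "a * t - 3 / 2" x]] assms
      by (simp add: vg_density_eq_gig_integral mult.left_commute)
    have c2: "isCont (?G (a * t - 1 / 2)) x" for x
      using assms mult_pos_pos[of a t] by (intro isCont_gig_integral_square) linarith+
    have "isCont \<Phi> x" for x
      unfolding \<Phi>_def
      by (rule isCont_add[OF isCont_mult[OF c1 DERIV_isCont[OF der(2)]]
            isCont_mult[OF isCont_mult[OF continuous_const c2] DERIV_isCont[OF der(1)]]])
    then show "continuous_on {- (R + 1)..R + 1} \<Phi>"
      by (intro continuous_at_imp_continuous_on) auto
  qed (use R in auto)
  \<comment> \<open>At \<open>\<plusminus> (R + 1)\<close> both \<open>\<phi>\<close> and its
    derivative vanish, hence so does \<open>\<Phi>\<close>.\<close>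
  then have "(?I has_integral 0) {- (R + 1)..R + 1}"
    using R(1) supp by (simp add: \<Phi>_def)
  then have "(?I has_integral 0) UNIV"
    by (rule has_integral_on_superset) (use supp in auto)
  with has_integral_integral_lborel[OF int] show ?thesis
    by (rule has_integral_unique)
qed

text \<open>Unfolding the definitions puts the derivatives on
  \<open>\<lambda>x. x * \<phi> x\<close> and \<open>\<phi>\<close>; the Leibniz rule then gives the
  integrand of the weak equation.\<close>

lemma vg_density_distributional_ode:
  assumes "a > 0" "b > 0" "t > 0" "test_function \<phi>"
  shows "dist_mult (\<lambda>x. x) (dist_deriv (dist_deriv (regular_dist (vg_density a b t)))) \<phi>
          - (2 * a * t - 2) * dist_deriv (regular_dist (vg_density a b t)) \<phi>
          - b * dist_mult (\<lambda>x. x) (regular_dist (vg_density a b t)) \<phi> = 0"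
proof -
  note der = test_function_derivatives[OF assms(4), of 0, simplified]
    test_function_derivatives[OF assms(4), of "Suc 0", simplified]
  obtain R where R: "R > 0" "\<And>n x. R < \<bar>x\<bar> \<Longrightarrow> (deriv ^^ n) \<phi> x = 0"
    using test_function_support[OF assms(4)] by blast
  note supp = R(2)[of _ 0, simplified] R(2)[of _ "Suc 0", simplified] R(2)[of _ "Suc (Suc 0)", simplified]
  have cont: "continuous_on UNIV \<phi>" "continuous_on UNIV (deriv \<phi>)" "continuous_on UNIV (deriv (deriv \<phi>))"
    using test_function_derivatives[OF assms(4), of 0] test_function_derivatives[OF assms(4), of "Suc 0"]
      test_function_derivatives[OF assms(4), of "Suc (Suc 0)"]
    by (auto intro!: continuous_at_imp_continuous_on DERIV_isCont)
  have "deriv (\<lambda>x. x * \<phi> x) = (\<lambda>x. \<phi> x + x * deriv \<phi> x)"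
    using der by (intro ext DERIV_imp_deriv) (auto intro!: derivative_eq_intros)
  moreover have "deriv (\<lambda>x. \<phi> x + x * deriv \<phi> x) = (\<lambda>x. 2 * deriv \<phi> x + x * deriv (deriv \<phi>) x)"
    using der by (intro ext DERIV_imp_deriv) (auto intro!: derivative_eq_intros)
  \<comment> \<open>Integrability of each term separately allows the three integrals to be
    merged.\<close>
  moreover have "integrable lborel (\<lambda>x. vg_density a b t x * (2 * deriv \<phi> x + x * deriv (deriv \<phi>) x))"
    "integrable lborel (\<lambda>x. vg_density a b t x * deriv \<phi> x)"
    "integrable lborel (\<lambda>x. vg_density a b t x * (x * \<phi> x))"
    using assms cont supp
    by (auto intro!: integrable_mult_continuous_compact_support[where R = R] vg_density_integrable continuous_intros)
  ultimately have "dist_mult (\<lambda>x. x) (dist_deriv (dist_deriv (regular_dist (vg_density a b t)))) \<phi>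
          - (2 * a * t - 2) * dist_deriv (regular_dist (vg_density a b t)) \<phi>
          - b * dist_mult (\<lambda>x. x) (regular_dist (vg_density a b t)) \<phi>
      = (LBINT x. vg_density a b t x * (2 * deriv \<phi> x + x * deriv (deriv \<phi>) x)
         + (2 * a * t - 2) * (vg_density a b t x * deriv \<phi> x) - b * (vg_density a b t x * (x * \<phi> x)))"
    by (simp add: dist_mult_def dist_deriv_def regular_dist_def)
  also have "\<dots> = (LBINT x. vg_density a b t x * (2 * a * t * deriv \<phi> x + x * deriv (deriv \<phi>) x - b * x * \<phi> x))"
    by (rule Bochner_Integration.integral_cong) (simp_all add: algebra_simps)
  finally show ?thesis
    using vg_density_weak_ode[OF assms] by simp
qed

section \<open>Brownian motion at the time of a subordinator\<close>

text \<open>The path-valued process evaluated at a random time is measurable once the time takes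
  countably many values, so the subordinated process is reached through time grids of mesh
  \<open>1 / (n + 1)\<close>.\<close>

definition grid_time :: "nat \<Rightarrow> real \<Rightarrow> real" where
  "grid_time n s = real (nat \<lceil>s * real (Suc n)\<rceil>) / real (Suc n)"

lemma grid_time_nonneg: "grid_time n s \<ge> 0"
  by (simp add: grid_time_def)

lemma grid_time_measurable [measurable]: "grid_time n \<in> borel_measurable borel"
  unfolding grid_time_def by measurable

lemma grid_time_tendsto:
  assumes "s \<ge> 0"
  shows "(\<lambda>n. grid_time n s) \<longlonglongrightarrow> s"
proof (rule real_tendsto_sandwich)
  have *: "s * real (Suc n) \<le> real (nat \<lceil>s * real (Suc n)\<rceil>)"
    "real (nat \<lceil>s * real (Suc n)\<rceil>) \<le> s * real (Suc n) + 1" for n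
    using mult_nonneg_nonneg[OF assms, of "real (Suc n)"] by linarith+
  have "s \<le> grid_time n s" for n
    unfolding grid_time_def using *(1)[of n] by (simp add: pos_le_divide_eq)
  moreover have "grid_time n s \<le> s + 1 / real (Suc n)" for n
  proof -
    have "grid_time n s \<le> (s * real (Suc n) + 1) / real (Suc n)"
      unfolding grid_time_def by (intro divide_right_mono *) simp
    then show ?thesis by (simp add: add_divide_distrib)
  qed
  ultimately
  show "\<forall>\<^sub>F n in sequentially. s \<le> grid_time n s"
    "\<forall>\<^sub>F n in sequentially. grid_time n s \<le> s + 1 / real (Suc n)" by simp_all
  show "(\<lambda>n. s + 1 / real (Suc n)) \<longlonglongrightarrow> s"
    using tendsto_add[OF tendsto_const[of s] LIMSEQ_inverse_real_of_nat] by (simp add: inverse_eq_divide)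
qed simp

text \<open>Stated on the product of two path spaces, where the joint law of \<open>B\<close> and
  \<open>H\<close> lives. Splitting by the grid index leaves evaluations at fixed times.\<close>

lemma path_grid_time_measurable:
  fixes t :: real
  assumes "t \<ge> 0"
  shows "(\<lambda>z. fst z (grid_time n (snd z t))) 
    \<in> borel_measurable (Pi\<^sub>M {0..} (\<lambda>_. borel :: real measure) \<Otimes>\<^sub>M Pi\<^sub>M {0..} (\<lambda>_. borel :: real measure))"
proof -
  let ?P = "Pi\<^sub>M {0..} (\<lambda>_. borel) :: (real \<Rightarrow> real) measure"
  have "(\<lambda>z. fst z (real i / real (Suc n))) \<in> borel_measurable (?P \<Otimes>\<^sub>M ?P)" for i :: nat
    by (rule measurable_compose[OF measurable_fst measurable_component_singleton]) simp
  moreover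
  have [measurable]: "(\<lambda>z. snd z t) \<in> borel_measurable (?P \<Otimes>\<^sub>M ?P)"
    by (rule measurable_compose[OF measurable_snd measurable_component_singleton]) (use assms in simp)
  have "(\<lambda>z. nat \<lceil>snd z t * real (Suc n)\<rceil>) \<in> ?P \<Otimes>\<^sub>M ?P \<rightarrow>\<^sub>M count_space UNIV"
    by measurable
  ultimately show ?thesis
    unfolding grid_time_def
    by (rule measurable_compose_countable[where f = "\<lambda>i z. fst z (real i / real (Suc n))"
          and g = "\<lambda>z. nat \<lceil>snd z t * real (Suc n)\<rceil>"])
qed

context prob_space
begin

lemma subordinator_nonneg:
  assumes "subordinator H" "t \<ge> 0" "\<omega> \<in> space M"
  shows "H t \<omega> \<ge> 0"
proof -
  have "mono_on {0..} (\<lambda>t. H t \<omega>)" "H 0 \<omega> = 0"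
    using assms unfolding subordinator_def by auto
  then show ?thesis
    using mono_onD[of "{0..}" "\<lambda>t. H t \<omega>" 0 t] assms by simp
qed

lemma brownian_motion_measurable:
  "brownian_motion B \<Longrightarrow> s \<ge> 0 \<Longrightarrow> random_variable borel (B s)"
  by (simp add: brownian_motion_def)

lemma subordinator_measurable:
  "subordinator H \<Longrightarrow> t \<ge> 0 \<Longrightarrow> random_variable borel (H t)"
  by (simp add: subordinator_def)

lemma brownian_motion_char:
  assumes "brownian_motion B" "s \<ge> 0"
  shows "(CLINT \<omega>|M. iexp (u * B s \<omega>)) = exp (- s * u\<^sup>2)"
proof (cases "s = 0")
  \<comment> \<open>Only increments over positive times have a density; at time \<open>0\<close> the
    path is at \<open>0\<close>.\<close>
  case True
  have "(CLINT \<omega>|M. iexp (u * B s \<omega>)) = (CLINT \<omega>|M. 1)"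
    using assms True by (intro Bochner_Integration.integral_cong) (auto simp: brownian_motion_def)
  then show ?thesis by (simp add: True prob_space)
next
  case False
  with assms have s: "s > 0" by simp
  have [measurable]: "random_variable borel (B s)" "random_variable borel (B 0)"
    using assms by (simp_all add: brownian_motion_measurable)
  have "distributed M lborel (\<lambda>\<omega>. B s \<omega> - B 0 \<omega>) (\<lambda>x. ennreal (heat_density (s - 0) x))"
    using assms s unfolding brownian_motion_def by blast
  then have *: "distr M lborel (\<lambda>\<omega>. B s \<omega> - B 0 \<omega>) = density lborel (\<lambda>x. ennreal (heat_density s x))"
    by (simp add: distributed_distr_eq_density)
  have "(CLINT \<omega>|M. iexp (u * B s \<omega>)) = (CLINT \<omega>|M. iexp (u * (B s \<omega> - B 0 \<omega>)))"
    using assms by (intro Bochner_Integration.integral_cong) (auto simp: brownian_motion_def)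
  also have "\<dots> = (CLINT x|distr M lborel (\<lambda>\<omega>. B s \<omega> - B 0 \<omega>). iexp (u * x))"
    by (subst integral_distr) auto
  also have "\<dots> = (CLBINT x. heat_density s x *\<^sub>R iexp (u * x))"
    unfolding * using s by (subst integral_density) (auto simp: heat_density_nonneg)
  also have "\<dots> = exp (- s * u\<^sup>2)"
    by (rule heat_density_char[OF s])
  finally show ?thesis .
qed

context
  fixes B H :: "real \<Rightarrow> 'a \<Rightarrow> real"
  assumes B: "brownian_motion B" and H: "subordinator H" and indep: "independent_processes B H"
begin

lemma grid_subordinated_measurable:
  assumes "t \<ge> 0"
  shows "random_variable borel (\<lambda>\<omega>. B (grid_time n (H t \<omega>)) \<omega>)"
proof -
  have [measurable]: "random_variable borel (H t)" using H assms by (rule subordinator_measurable)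
  have "(\<lambda>\<omega>. B (real i / real (Suc n)) \<omega>) \<in> borel_measurable M" for i :: nat
    using B by (intro brownian_motion_measurable) auto
  moreover have "(\<lambda>\<omega>. nat \<lceil>H t \<omega> * real (Suc n)\<rceil>) \<in> M \<rightarrow>\<^sub>M count_space UNIV"
    by measurable
  ultimately show ?thesis
    unfolding grid_time_def by (rule measurable_compose_countable)
qed

lemma grid_subordinated_tendsto:
  assumes "t \<ge> 0" "\<omega> \<in> space M"
  shows "(\<lambda>n. B (grid_time n (H t \<omega>)) \<omega>) \<longlonglongrightarrow> subordinated B H t \<omega>"
proof -
  have "continuous_on {0..} (\<lambda>s. B s \<omega>)" using B assms by (auto simp: brownian_motion_def)
  moreover have "H t \<omega> \<ge> 0" using subordinator_nonneg H assms by blast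
  ultimately show ?thesis
    unfolding subordinated_def
    by (intro continuous_on_tendsto_compose[where f = "\<lambda>s. B s \<omega>"] grid_time_tendsto)
      (auto simp: grid_time_nonneg)
qed

lemma subordinated_measurable:
  assumes "t \<ge> 0"
  shows "random_variable borel (subordinated B H t)"
  by (rule borel_measurable_LIMSEQ_real[OF grid_subordinated_tendsto grid_subordinated_measurable])
    (use assms in auto)

text \<open>Independence makes the joint law of the paths a product, so Fubini freezes the path of
  \<open>H\<close>; what remains is the characteristic function of \<open>B\<close> at a fixed
  time.\<close>

lemma grid_subordinated_char:
  assumes t: "t \<ge> 0"
  shows "(CLINT \<omega>|M. iexp (u * B (grid_time n (H t \<omega>)) \<omega>)) = of_real (LINT \<omega>|M. exp (- grid_time n (H t \<omega>) * u\<^sup>2))"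
proof -
  let ?P = "Pi\<^sub>M {0..} (\<lambda>_. borel) :: (real \<Rightarrow> real) measure"
  define W where "W \<omega> = (\<lambda>s\<in>{0..}. B s \<omega>)" for \<omega>
  define Z where "Z \<omega> = (\<lambda>s\<in>{0..}. H s \<omega>)" for \<omega>
  define F where "F p q = iexp (u * p (grid_time n (q t)))" for p q :: "real \<Rightarrow> real"
  have "indep_var ?P W ?P Z"
    using indep unfolding independent_processes_def W_def Z_def .
  then have W [measurable]: "random_variable ?P W" and Z [measurable]: "random_variable ?P Z"
    and joint: "distr M (?P \<Otimes>\<^sub>M ?P) (\<lambda>\<omega>. (W \<omega>, Z \<omega>)) = distr M ?P W \<Otimes>\<^sub>M distr M ?P Z"
    unfolding indep_var_distribution_eq by simp_all
  interpret PW: prob_space "distr M ?P W" by (rule prob_space_distr) (rule W)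
  interpret PZ: prob_space "distr M ?P Z" by (rule prob_space_distr) (rule Z)
  interpret PP: pair_prob_space "distr M ?P W" "distr M ?P Z" ..
  note [measurable] = path_grid_time_measurable[OF t]
  have ev [measurable]: "(\<lambda>q. q t) \<in> borel_measurable ?P"
    by (rule measurable_component_singleton) (simp add: t)
  have Fm: "case_prod F \<in> borel_measurable (?P \<Otimes>\<^sub>M ?P)"
    unfolding F_def split_beta' by measurable
  then have Fm': "case_prod F \<in> borel_measurable (distr M ?P W \<Otimes>\<^sub>M distr M ?P Z)"
    by (simp only: measurable_cong_sets[OF sets_pair_measure_cong[OF sets_distr sets_distr] refl])
  have Fi: "integrable (distr M ?P W \<Otimes>\<^sub>M distr M ?P Z) (case_prod F)"
    by (rule PP.P.integrable_const_bound[OF _ Fm', where B = 1]) (auto simp: F_def)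
  \<comment> \<open>\<open>W\<close> and \<open>Z\<close> are restricted to \<open>{0..}\<close>;
    \<open>t\<close> and all grid times are nonnegative, so evaluation does not see the
    restriction.\<close>
  have "(CLINT \<omega>|M. iexp (u * B (grid_time n (H t \<omega>)) \<omega>)) = (CLINT \<omega>|M. case_prod F (W \<omega>, Z \<omega>))"
    using t by (simp add: F_def W_def Z_def grid_time_nonneg)
  also have "\<dots> = (CLINT z|distr M ?P W \<Otimes>\<^sub>M distr M ?P Z. case_prod F z)"
    unfolding joint [symmetric] by (rule integral_distr[OF _ Fm, symmetric]) measurable
  also have "\<dots> = (CLINT q|distr M ?P Z. CLINT p|distr M ?P W. F p q)"
    by (rule PP.integral_snd [symmetric]) (rule Fi)
  also have "\<dots> = (CLINT q|distr M ?P Z. of_real (exp (- grid_time n (q t) * u\<^sup>2)))"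
  proof (rule Bochner_Integration.integral_cong [OF refl])
    fix q :: "real \<Rightarrow> real"
    have [measurable]: "(\<lambda>p. p (grid_time n (q t))) \<in> borel_measurable ?P"
      by (rule measurable_component_singleton) (simp add: grid_time_nonneg)
    have "(CLINT p|distr M ?P W. F p q) = (CLINT \<omega>|M. F (W \<omega>) q)"
      unfolding F_def by (rule integral_distr) measurable
    also have "\<dots> = (CLINT \<omega>|M. iexp (u * B (grid_time n (q t)) \<omega>))"
      by (simp add: F_def W_def grid_time_nonneg)
    also have "\<dots> = of_real (exp (- grid_time n (q t) * u\<^sup>2))"
      by (rule brownian_motion_char[OF B grid_time_nonneg])
    finally show "(CLINT p|distr M ?P W. F p q) = of_real (exp (- grid_time n (q t) * u\<^sup>2))" .
  qed
  also have "\<dots> = (CLINT \<omega>|M. of_real (exp (- grid_time n (Z \<omega> t) * u\<^sup>2)))"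
    by (rule integral_distr) measurable
  also have "\<dots> = (CLINT \<omega>|M. of_real (exp (- grid_time n (H t \<omega>) * u\<^sup>2)))"
    using t by (simp add: Z_def)
  finally show ?thesis by (simp only: integral_complex_of_real)
qed

text \<open>Refining the grid, both sides converge by dominated convergence with bound
  \<open>1\<close>; on the left this uses path continuity of \<open>B\<close>.\<close>

lemma subordinated_char:
  assumes t: "t \<ge> 0"
  shows "(CLINT \<omega>|M. iexp (u * subordinated B H t \<omega>)) = of_real (LINT \<omega>|M. exp (- u\<^sup>2 * H t \<omega>))"
proof (rule LIMSEQ_unique)
  note [measurable] = subordinator_measurable[OF H t] subordinated_measurable[OF t] grid_subordinated_measurable[OF t]
  show "(\<lambda>n. CLINT \<omega>|M. iexp (u * B (grid_time n (H t \<omega>)) \<omega>)) \<longlonglongrightarrow> (CLINT \<omega>|M. iexp (u * subordinated B H t \<omega>))"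
  proof (rule integral_dominated_convergence[where w = "\<lambda>_. 1"])
    show "AE \<omega> in M. (\<lambda>n. iexp (u * B (grid_time n (H t \<omega>)) \<omega>)) \<longlonglongrightarrow> iexp (u * subordinated B H t \<omega>)"
      using grid_subordinated_tendsto[OF t] by (auto intro!: tendsto_intros)
  qed auto
  have "(\<lambda>n. LINT \<omega>|M. exp (- grid_time n (H t \<omega>) * u\<^sup>2)) \<longlonglongrightarrow> (LINT \<omega>|M. exp (- u\<^sup>2 * H t \<omega>))"
  proof (rule integral_dominated_convergence[where w = "\<lambda>_. 1"])
    show "AE \<omega> in M. (\<lambda>n. exp (- grid_time n (H t \<omega>) * u\<^sup>2)) \<longlonglongrightarrow> exp (- u\<^sup>2 * H t \<omega>)"
      using grid_time_tendsto subordinator_nonneg[OF H t]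
      by (auto intro!: AE_I2 tendsto_eq_intros)
  qed (auto simp: grid_time_nonneg)
  then show "(\<lambda>n. CLINT \<omega>|M. iexp (u * B (grid_time n (H t \<omega>)) \<omega>)) \<longlonglongrightarrow> of_real (LINT \<omega>|M. exp (- u\<^sup>2 * H t \<omega>))"
    unfolding grid_subordinated_char[OF t] by (rule tendsto_of_real)
qed

section \<open>The initial condition\<close>

lemma subordinated_0: "\<omega> \<in> space M \<Longrightarrow> subordinated B H 0 \<omega> = 0"
  using B H by (simp add: subordinated_def brownian_motion_def subordinator_def)

lemma distr_subordinated_0: "distr M borel (subordinated B H 0) = return borel 0"
proof -
  have "distr M borel (subordinated B H 0) = distr M borel (\<lambda>_. 0)"
    by (rule distr_cong) (simp_all add: subordinated_0)
  also have "\<dots> = return borel 0" by (rule distr_const) simp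
  finally show ?thesis .
qed

text \<open>Right-continuity of \<open>H\<close> at \<open>0\<close> is composed with path
  continuity of \<open>B\<close>. The latter holds on \<open>{0..}\<close>, which is where
  nonnegativity of \<open>H\<close> enters.\<close>

lemma subordinated_tendsto_0:
  assumes "\<omega> \<in> space M"
  shows "((\<lambda>t. subordinated B H t \<omega>) \<longlongrightarrow> 0) (at_right 0)"
proof -
  have "continuous_on {0..} (\<lambda>s. B s \<omega>)" "B 0 \<omega> = 0"
    using B assms by (auto simp: brownian_motion_def)
  moreover have "((\<lambda>t. H t \<omega>) \<longlongrightarrow> 0) (at_right 0)"
    using H assms unfolding subordinator_def continuous_within by (metis order_refl)
  moreover have "\<forall>\<^sub>F t in at_right 0. H t \<omega> \<in> {0..}"
    using subordinator_nonneg[OF H _ assms] by (auto simp: eventually_at_filter)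
  ultimately show ?thesis
    unfolding subordinated_def using continuous_on_tendsto_compose[of "{0..}" "\<lambda>s. B s \<omega>"] by fastforce
qed

text \<open>Dominated convergence along paths; arguing with the process avoids estimates of the
  density for small times.\<close>

lemma expectation_subordinated_tendsto:
  fixes f :: "real \<Rightarrow> real"
  assumes "continuous_on UNIV f" "bounded (range f)"
  shows "((\<lambda>t. expectation (\<lambda>\<omega>. f (subordinated B H t \<omega>))) \<longlongrightarrow> f 0) (at_right 0)"
  unfolding tendsto_at_iff_sequentially
proof safe
  fix D :: "nat \<Rightarrow> real"
  assume D: "\<forall>i. D i \<in> {0<..} - {0}" "D \<longlonglongrightarrow> 0"
  have pos: "D i > 0" for i using D(1)[rule_format, of i] by simp
  then have "filterlim D (at_right 0) sequentially"
    using D(2) by (simp add: filterlim_at less_imp_neq[OF pos, symmetric])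
  then have lim: "(\<lambda>i. subordinated B H (D i) \<omega>) \<longlonglongrightarrow> 0" if "\<omega> \<in> space M" for \<omega>
    using filterlim_compose subordinated_tendsto_0[OF that] by blast
  have [measurable]: "f \<in> borel_measurable borel"
    using assms(1) by (rule borel_measurable_continuous_onI)
  have [measurable]: "random_variable borel (subordinated B H (D i))" for i
    using D(1)[rule_format, of i] by (intro subordinated_measurable) auto
  obtain K where K: "\<And>x. \<bar>f x\<bar> \<le> K" using assms(2) by (auto simp: bounded_iff)
  have "(\<lambda>i. expectation (\<lambda>\<omega>. f (subordinated B H (D i) \<omega>))) \<longlonglongrightarrow> expectation (\<lambda>\<omega>. f 0)"
  proof (rule integral_dominated_convergence[where w = "\<lambda>_. K"])
    show "AE \<omega> in M. (\<lambda>i. f (subordinated B H (D i) \<omega>)) \<longlonglongrightarrow> f 0"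
      by (intro AE_I2 continuous_on_tendsto_compose[OF assms(1)] lim) auto
  qed (auto simp: K)
  then show "((\<lambda>t. expectation (\<lambda>\<omega>. f (subordinated B H t \<omega>))) \<circ> D) \<longlonglongrightarrow> f 0"
    by (simp add: comp_def prob_space)
qed

end

text \<open>Levy's uniqueness theorem: both laws have the characteristic function
  \<open>exp (- t * a * ln (1 + u\<^sup>2 / b))\<close>.\<close>

lemma distributed_variance_gamma:
  assumes B: "brownian_motion B" and H: "gamma_subordinator a b H" and indep: "independent_processes B H"
    and "a > 0" "b > 0" "t > 0"
  shows "distributed M lborel (subordinated B H t) (\<lambda>x. ennreal (vg_density a b t x))"
proof -
  have H': "subordinator H"
    and lap: "\<And>l. l > 0 \<Longrightarrow> expectation (\<lambda>\<omega>. exp (- l * H t \<omega>)) = exp (- t * a * ln (1 + l / b))"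
    using H assms unfolding gamma_subordinator_def by auto
  note [measurable] = subordinated_measurable[OF B H' indep less_imp_le[OF \<open>t > 0\<close>]]
  have "distr M borel (subordinated B H t) = density lborel (\<lambda>x. ennreal (vg_density a b t x))"
  proof (rule Levy_uniqueness)
    show "char (distr M borel (subordinated B H t)) = char (density lborel (\<lambda>x. ennreal (vg_density a b t x)))"
    proof
      fix u
      have "char (distr M borel (subordinated B H t)) u = (CLINT \<omega>|M. iexp (u * subordinated B H t \<omega>))"
        unfolding char_def by (rule integral_distr) measurable
      also have "\<dots> = of_real (expectation (\<lambda>\<omega>. exp (- u\<^sup>2 * H t \<omega>)))"
        using \<open>t > 0\<close> by (intro subordinated_char[OF B H' indep]) simp
      \<comment> \<open>The Laplace transform is given for \<open>l > 0\<close>; at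
        \<open>u = 0\<close> both sides are \<open>1\<close>.\<close>
      also have "expectation (\<lambda>\<omega>. exp (- u\<^sup>2 * H t \<omega>)) = exp (- t * a * ln (1 + u\<^sup>2 / b))"
        using lap[of "u\<^sup>2"] by (cases "u = 0") (simp_all add: prob_space)
      also have "of_real \<dots> = char (density lborel (\<lambda>x. ennreal (vg_density a b t x))) u"
        using assms by (simp only: char_vg)
      finally show "char (distr M borel (subordinated B H t)) u = char (density lborel (\<lambda>x. ennreal (vg_density a b t x))) u" .
    qed
  qed (use assms in \<open>auto intro: real_distribution_vg real_distribution_distr\<close>)
  moreover have "distr M lborel (subordinated B H t) = distr M borel (subordinated B H t)"
    by (rule distr_cong) simp_all
  ultimately show ?thesis
    unfolding distributed_def by simp
qed

end

section \<open>The Variance Gamma process\<close>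

theorem theorem3p2:
  fixes M :: "'a measure" and B H X :: "real \<Rightarrow> 'a \<Rightarrow> real" and a b :: real
    and p :: "real \<Rightarrow> real \<Rightarrow> real"
  assumes "prob_space M"
    and "a > 0" and "b > 0"
    and "prob_space.gamma_subordinator M a b H"
    and "prob_space.brownian_motion M B"
    and "prob_space.independent_processes M B H"
  defines "X \<equiv> subordinated B H"
    and "p \<equiv> vg_density a b"
  shows
    \<comment> \<open>\<open>p\<close> is the density of the process\<close>
    "(\<forall>t>0. distributed M lborel (X t) (\<lambda>x. ennreal (p t x)))
     \<comment> \<open>the equation, pointwise wherever \<open>p t\<close> is twice differentiable\<close>
     \<and> (\<forall>t>0. \<forall>x. x \<noteq> 0 \<or> a * t > 3 / 2 \<longrightarrow>
          p t field_differentiable (at x) \<and>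
          deriv (p t) field_differentiable (at x) \<and>
          x * deriv (deriv (p t)) x - (2 * a * t - 2) * deriv (p t) x - b * x * p t x = 0)
     \<comment> \<open>the equation on the whole line, in the sense of distributions\<close>
     \<and> (\<forall>t>0. \<forall>\<phi>. test_function \<phi> \<longrightarrow>
          dist_mult (\<lambda>x. x) (dist_deriv (dist_deriv (regular_dist (p t)))) \<phi>
          - (2 * a * t - 2) * dist_deriv (regular_dist (p t)) \<phi>
          - b * dist_mult (\<lambda>x. x) (regular_dist (p t)) \<phi> = 0)
     \<comment> \<open>the initial condition: the law at time \<open>0\<close> is the Dirac measure, attained weakly\<close>
     \<and> distr M borel (X 0) = return borel 0
     \<and> (\<forall>f :: real \<Rightarrow> real. continuous_on UNIV f \<and> bounded (range f) \<longrightarrow>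
          ((\<lambda>t. LBINT x. f x * p t x) \<longlongrightarrow> f 0) (at_right 0))"
proof -
  interpret prob_space M by fact
  note H = assms(4) and B = assms(5) and indep = assms(6)
  have H': "subordinator H"
    using H by (simp add: gamma_subordinator_def)
  have dens: "distributed M lborel (X t) (\<lambda>x. ennreal (p t x))" if "t > 0" for t
    unfolding X_def p_def using B H indep \<open>a > 0\<close> \<open>b > 0\<close> that by (rule distributed_variance_gamma)
  have init: "((\<lambda>t. LBINT x. f x * p t x) \<longlongrightarrow> f 0) (at_right 0)"
    if f: "continuous_on UNIV f" "bounded (range f)" for f :: "real \<Rightarrow> real"
  proof (rule Lim_transform_eventually)
    show "((\<lambda>t. expectation (\<lambda>\<omega>. f (X t \<omega>))) \<longlongrightarrow> f 0) (at_right 0)"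
      unfolding X_def by (rule expectation_subordinated_tendsto[OF B H' indep f])
    \<comment> \<open>For positive \<open>t\<close> the law of \<open>X t\<close> has density
      \<open>p t\<close>, and \<open>at_right 0\<close> sees only such \<open>t\<close>.\<close>
    have "expectation (\<lambda>\<omega>. f (X t \<omega>)) = (LBINT x. f x * p t x)" if "t > 0" for t
      using distributed_integral[OF dens[OF that], of f] f(1) vg_density_nonneg[OF \<open>a > 0\<close> that]
      by (simp add: p_def mult.commute borel_measurable_continuous_onI)
    then show "\<forall>\<^sub>F t in at_right 0. expectation (\<lambda>\<omega>. f (X t \<omega>)) = (LBINT x. f x * p t x)"
      by (simp add: eventually_at_filter)
  qed
  show ?thesis
    using dens init vg_density_ode[OF \<open>b > 0\<close>] vg_density_distributional_ode[OF \<open>a > 0\<close> \<open>b > 0\<close>]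
      distr_subordinated_0[OF B H' indep]
    unfolding X_def p_def by (intro conjI allI impI) blast+
qed

end
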